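(* Let $\tau$ be a rollout with influence-dependency data and trajectory advantage $\hat A_\tau$ as defined in the context. (1) If the active graph features are constant in the action index $i$, then the corresponding multipliers and routing weights are all one and every token receives the same advantage. Explicitly: (a) if $\hat A_\tau>0$ and both $\phi_1^{+}=\dots=\phi_T^{+}$ and $\phi_1^{-}=\dots=\phi_T^{-}$, then $m_i^{+}=m_i^{-}=1$ and $w_i=1$ for all $i$, and $A_{i,\ell}=\hat A_\tau$ for every token $\ell$ of every action $a_i$; (b) if $\hat A_\tau<0$ and $\phi_1^{-}=\dots=\phi_T^{-}$, then $m_i^{-}=1$ and $w_i=1$ for all $i$, and $A_{i,\ell}=\hat A_\tau$ for every token $\ell$ of every action $a_i$. (2) If there is no observable error, i.e. $e_i=0$ for all $i$, then $\phi_i^{-}$ is constant in $i$ and the negative branch is uniform: $w_i^{-}=1$ for all $i$.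
   Context: Rollout. A rollout $\tau$ consists of $T\ge 1$ actions $a_1,\dots,a_T$; action $a_i$ has $L_i\ge 1$ tokens, and $L=\sum_{i=1}^T L_i$. Its trajectory advantage is the real number $\hat A_\tau=(R_\tau-\mu_{\mathcal G})/(\sigma_{\mathcal G}+\varepsilon)$, where $R_\tau\in\mathbb R$ is the terminal reward of $\tau$, and $\mu_{\mathcal G},\sigma_{\mathcal G}$ are the mean and standard deviation of the terminal rewards over a finite group $\mathcal G$ of $K$ rollouts containing $\tau$. Throughout $\varepsilon=10^{-6}$. Influence-dependency data. Edge sets $E^{+},E^{-}\subseteq\{(i,j):1\le i<j\le T\}$ (support-use and failed-use edges), error indicators $e_i\in\{0,1\}$, and direct-input counts $u_i^{\mathrm{dir}}\in\mathbb Z_{\ge 0}$ for $1\le i\le T$. Put $d_i^{+}=|\{j:(i,j)\in E^{+}\}|$, $d_i^{-}=|\{j:(i,j)\in E^{-}\}|$, $d_i^{\mathrm{in}}=u_i^{\mathrm{dir}}+|\{k:(k,i)\in E^{+}\}|$. It is assumed that $d_i^{-}>0$ implies $e_i=1$. Graph features. $\phi_i^{+}=\log(1+d_i^{+}+d_i^{\mathrm{in}})$ and $\phi_i^{-}=\log\bigl(1+e_i(1+d_i^{-}+d_i^{\mathrm{in}})\bigr)$. Normalization. Fix a clipping constant $c>0$, with $\mathrm{clip}(z,-c,c)=\max(-c,\min(z,c))$. For $\phi\in\mathbb R_{\ge 0}^T$ let $\bar\phi=\frac1L\sum_i L_i\phi_i$, $\sigma_\phi^2=\frac1L\sum_i L_i(\phi_i-\bar\phi)^2$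 (with $\sigma_\phi\ge 0$), $z_i=(\phi_i-\bar\phi)/(\sigma_\phi+\varepsilon)$, and $$m_i=\frac{\exp(\mathrm{clip}(z_i,-c,c))}{\frac1L\sum_j L_j\exp(\mathrm{clip}(z_j,-c,c))}.$$ Write $m_i^{+}$ and $m_i^{-}$ for the values obtained from $\phi=\phi^{+}$ and $\phi=\phi^{-}$ respectively. Routing weights. Fix $\beta_{+}\ge 0$ and let $\psi_i^{-}=\phi_i^{-}-\bar\phi^{-}$ with $\bar\phi^{-}=\frac1L\sum_i L_i\phi_i^{-}$. Define $$w_i^{+}=\frac{L\,m_i^{+}\exp(-\beta_{+}\psi_i^{-})}{\sum_j L_j\,m_j^{+}\exp(-\beta_{+}\psi_j^{-})},\qquad w_i^{-}=m_i^{-}.$$ Routed advantage. Every token $\ell$ of action $a_i$ receives $A_{i,\ell}=\hat A_\tau\,w_i$, where $w_i=w_i^{+}$ if $\hat A_\tau>0$ and $w_i=w_i^{-}$ if $\hat A_\tau<0$; if $\hat A_\tau=0$ then $A_{i,\ell}=0$. Active features. The active graph features are those entering the weight that is used: $\phi^{+}$ and $\phi^{-}$ when $\hat A_\tau>0$, and $\phi^{-}$ when $\hat A_\tau<0$. *)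

theory Defs
  imports "HOL-Analysis.Analysis"
begin

text \<open>Actions are numbered \<open>1, \<dots>, T\<close>; only the values of index-dependent data at these
  indices are meaningful.\<close>

record rollout =
  horizon :: nat                  \<comment> \<open>\<open>T\<close>\<close>
  tokens :: "nat \<Rightarrow> nat"          \<comment> \<open>\<open>L\<^sub>i\<close>\<close>
  reward :: real                  \<comment> \<open>\<open>R\<^sub>\<tau>\<close>\<close>

abbreviation acts :: "rollout \<Rightarrow> nat set" where
  "acts \<tau> \<equiv> {1..horizon \<tau>}"

definition valid_rollout :: "rollout \<Rightarrow> bool" where
  "valid_rollout \<tau> \<longleftrightarrow> 1 \<le> horizon \<tau> \<and> (\<forall>i\<in>acts \<tau>. 1 \<le> tokens \<tau> i)"

definition total_tokens :: "rollout \<Rightarrow> nat" where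
  "total_tokens \<tau> = (\<Sum>i\<in>acts \<tau>. tokens \<tau> i)"

definition eps :: real where
  "eps = 1 / 10 ^ 6"

text \<open>A group is a list, so that rollouts may occur repeatedly; the standard deviation is the
  population one (divisor \<open>K\<close>, the length of the list).\<close>

definition group_mean :: "rollout list \<Rightarrow> real" where
  "group_mean G = (\<Sum>\<rho>\<leftarrow>G. reward \<rho>) / real (length G)"

definition group_std :: "rollout list \<Rightarrow> real" where
  "group_std G = sqrt ((\<Sum>\<rho>\<leftarrow>G. (reward \<rho> - group_mean G)\<^sup>2) / real (length G))"

definition traj_adv :: "rollout list \<Rightarrow> rollout \<Rightarrow> real" where
  "traj_adv G \<tau> = (reward \<tau> - group_mean G) / (group_std G + eps)"

record influence =
  support_use :: "(nat \<times> nat) set"   \<comment> \<open>\<open>E\<^sup>+\<close>\<close>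
  failed_use :: "(nat \<times> nat) set"    \<comment> \<open>\<open>E\<^sup>-\<close>\<close>
  err :: "nat \<Rightarrow> nat"                \<comment> \<open>\<open>e\<^sub>i\<close>\<close>
  direct_inputs :: "nat \<Rightarrow> nat"

definition deg_pos :: "influence \<Rightarrow> nat \<Rightarrow> nat" where
  "deg_pos D i = card {j. (i, j) \<in> support_use D}"

definition deg_neg :: "influence \<Rightarrow> nat \<Rightarrow> nat" where
  "deg_neg D i = card {j. (i, j) \<in> failed_use D}"

definition deg_in :: "influence \<Rightarrow> nat \<Rightarrow> nat" where
  "deg_in D i = direct_inputs D i + card {k. (k, i) \<in> support_use D}"

definition valid_influence :: "rollout \<Rightarrow> influence \<Rightarrow> bool" where
  "valid_influence \<tau> D \<longleftrightarrow>
     support_use D \<subseteq> {(i, j). 1 \<le> i \<and> i < j \<and> j \<le> horizon \<tau>} \<and>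
     failed_use D \<subseteq> {(i, j). 1 \<le> i \<and> i < j \<and> j \<le> horizon \<tau>} \<and>
     (\<forall>i\<in>acts \<tau>. err D i \<in> {0, 1}) \<and>
     (\<forall>i\<in>acts \<tau>. 0 < deg_neg D i \<longrightarrow> err D i = 1)"

definition phi_pos :: "influence \<Rightarrow> nat \<Rightarrow> real" where
  "phi_pos D i = ln (1 + real (deg_pos D i) + real (deg_in D i))"

definition phi_neg :: "influence \<Rightarrow> nat \<Rightarrow> real" where
  "phi_neg D i = ln (1 + real (err D i) * (1 + real (deg_neg D i) + real (deg_in D i)))"

definition clip :: "real \<Rightarrow> real \<Rightarrow> real \<Rightarrow> real" where
  "clip z lo hi = max lo (min z hi)"

definition token_mean :: "rollout \<Rightarrow> (nat \<Rightarrow> real) \<Rightarrow> real" where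
  "token_mean \<tau> f = 1 / real (total_tokens \<tau>) * (\<Sum>i\<in>acts \<tau>. real (tokens \<tau> i) * f i)"

definition token_std :: "rollout \<Rightarrow> (nat \<Rightarrow> real) \<Rightarrow> real" where
  "token_std \<tau> \<phi> = sqrt (token_mean \<tau> (\<lambda>i. (\<phi> i - token_mean \<tau> \<phi>)\<^sup>2))"

definition zscore :: "rollout \<Rightarrow> (nat \<Rightarrow> real) \<Rightarrow> nat \<Rightarrow> real" where
  "zscore \<tau> \<phi> i = (\<phi> i - token_mean \<tau> \<phi>) / (token_std \<tau> \<phi> + eps)"

definition multiplier :: "real \<Rightarrow> rollout \<Rightarrow> (nat \<Rightarrow> real) \<Rightarrow> nat \<Rightarrow> real" where
  "multiplier c \<tau> \<phi> i =
     exp (clip (zscore \<tau> \<phi> i) (- c) c)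
       / token_mean \<tau> (\<lambda>j. exp (clip (zscore \<tau> \<phi> j) (- c) c))"

definition mult_pos :: "real \<Rightarrow> rollout \<Rightarrow> influence \<Rightarrow> nat \<Rightarrow> real" where
  "mult_pos c \<tau> D = multiplier c \<tau> (phi_pos D)"

definition mult_neg :: "real \<Rightarrow> rollout \<Rightarrow> influence \<Rightarrow> nat \<Rightarrow> real" where
  "mult_neg c \<tau> D = multiplier c \<tau> (phi_neg D)"

definition psi_neg :: "rollout \<Rightarrow> influence \<Rightarrow> nat \<Rightarrow> real" where
  "psi_neg \<tau> D i = phi_neg D i - token_mean \<tau> (phi_neg D)"

definition weight_pos :: "real \<Rightarrow> real \<Rightarrow> rollout \<Rightarrow> influence \<Rightarrow> nat \<Rightarrow> real" where
  "weight_pos c \<beta> \<tau> D i =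
     real (total_tokens \<tau>) * mult_pos c \<tau> D i * exp (- \<beta> * psi_neg \<tau> D i)
       / (\<Sum>j\<in>acts \<tau>. real (tokens \<tau> j) * mult_pos c \<tau> D j * exp (- \<beta> * psi_neg \<tau> D j))"

definition weight_neg :: "real \<Rightarrow> rollout \<Rightarrow> influence \<Rightarrow> nat \<Rightarrow> real" where
  "weight_neg c \<tau> D i = mult_neg c \<tau> D i"

text \<open>No weight is specified for a vanishing trajectory advantage.\<close>

definition routing_weight ::
  "real \<Rightarrow> real \<Rightarrow> rollout list \<Rightarrow> rollout \<Rightarrow> influence \<Rightarrow> nat \<Rightarrow> real" where
  "routing_weight c \<beta> G \<tau> D i =
     (if traj_adv G \<tau> > 0 then weight_pos c \<beta> \<tau> D i
      else if traj_adv G \<tau> < 0 then weight_neg c \<tau> D i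
      else undefined)"

text \<open>The advantage of the \<open>l\<close>-th token of the \<open>i\<close>-th action; it does not depend on \<open>l\<close>.\<close>

definition routed_adv ::
  "real \<Rightarrow> real \<Rightarrow> rollout list \<Rightarrow> rollout \<Rightarrow> influence \<Rightarrow> nat \<Rightarrow> nat \<Rightarrow> real" where
  "routed_adv c \<beta> G \<tau> D i l =
     (if traj_adv G \<tau> = 0 then 0 else traj_adv G \<tau> * routing_weight c \<beta> G \<tau> D i)"

end

theory Submission
  imports Defs
begin

text \<open>Every normalization here divides by a token-weighted mean, and a token-weighted mean
  with total mass L > 0 reproduces constants (\<open>token_mean_const\<close>). If a feature is
  constant over the actions, so are its z-scores and their clipped exponentials; each of these
  equals its own mean, and the multiplier is 1 (\<open>multiplier_const\<close>). In the positive
  branch the factor exp(-\<beta> \<psi>) is then constant as well and cancels against the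
  normalizing sum (\<open>weight_pos_const\<close>). Without errors, \<phi>^- vanishes on all
  actions, so the negative branch is an instance of the constant case.\<close>

lemma total_tokens_pos:
  assumes "valid_rollout \<tau>"
  shows "0 < total_tokens \<tau>"
proof -
  have "1 \<in> acts \<tau>" and "0 < tokens \<tau> 1"
    using assms by (auto simp: valid_rollout_def Suc_le_eq)
  then show ?thesis
    unfolding total_tokens_def by (intro sum_pos2) auto
qed

lemma token_mean_const:
  assumes "valid_rollout \<tau>" and "\<And>i. i \<in> acts \<tau> \<Longrightarrow> f i = a"
  shows "token_mean \<tau> f = a"
proof -
  have "(\<Sum>i\<in>acts \<tau>. real (tokens \<tau> i) * f i) = real (total_tokens \<tau>) * a"
    using assms(2) by (simp add: total_tokens_def sum_distrib_right)
  \<comment> \<open>Cancelling L needs L > 0, since division by zero yields 0 in HOL.\<close>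
  then show ?thesis
    using total_tokens_pos[OF assms(1)] by (simp add: token_mean_def)
qed

text \<open>Only equality of the z-scores matters: their common value, the deviation and the
  clipping bounds stay unevaluated, because a positive constant divided by its own mean is
  1.\<close>

lemma multiplier_const:
  assumes "valid_rollout \<tau>" and "\<forall>i\<in>acts \<tau>. \<forall>j\<in>acts \<tau>. \<phi> i = \<phi> j" and "i \<in> acts \<tau>"
  shows "multiplier c \<tau> \<phi> i = 1"
proof -
  have "zscore \<tau> \<phi> j = zscore \<tau> \<phi> i" if "j \<in> acts \<tau>" for j
    using assms(2,3) that unfolding zscore_def by metis
  then have "token_mean \<tau> (\<lambda>j. exp (clip (zscore \<tau> \<phi> j) (- c) c))
      = exp (clip (zscore \<tau> \<phi> i) (- c) c)"
    by (intro token_mean_const[OF assms(1)]) simp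
  then show ?thesis
    by (simp add: multiplier_def)
qed

lemma weight_pos_const:
  assumes "valid_rollout \<tau>"
    and "\<forall>i\<in>acts \<tau>. \<forall>j\<in>acts \<tau>. phi_pos D i = phi_pos D j"
    and "\<forall>i\<in>acts \<tau>. \<forall>j\<in>acts \<tau>. phi_neg D i = phi_neg D j"
    and "i \<in> acts \<tau>"
  shows "weight_pos c \<beta> \<tau> D i = 1"
proof -
  have m: "mult_pos c \<tau> D j = 1" if "j \<in> acts \<tau>" for j
    using multiplier_const[OF assms(1,2) that] by (simp add: mult_pos_def)
  \<comment> \<open>The fixed action \<open>i\<close> serves as representative, so the exponential
    pulled out of the sum is literally the one in the numerator of
    \<open>weight_pos\<close>.\<close>
  have "psi_neg \<tau> D j = psi_neg \<tau> D i" if "j \<in> acts \<tau>" for j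
    using assms(3,4) that unfolding psi_neg_def by metis
  then have "(\<Sum>j\<in>acts \<tau>. real (tokens \<tau> j) * mult_pos c \<tau> D j * exp (- \<beta> * psi_neg \<tau> D j))
      = (\<Sum>j\<in>acts \<tau>. real (tokens \<tau> j) * exp (- \<beta> * psi_neg \<tau> D i))"
    by (intro sum.cong) (simp_all add: m)
  also have "\<dots> = real (total_tokens \<tau>) * exp (- \<beta> * psi_neg \<tau> D i)"
    by (simp add: total_tokens_def sum_distrib_right)
  finally show ?thesis
    using m[OF assms(4)] total_tokens_pos[OF assms(1)] by (simp add: weight_pos_def)
qed

theorem proposition2:
  fixes G :: "rollout list" and \<tau> :: rollout and D :: influence and c \<beta> :: real
  assumes "\<forall>\<rho>\<in>set G. valid_rollout \<rho>"
    and "\<tau> \<in> set G"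
    and "valid_influence \<tau> D"
    and "c > 0"
    and "\<beta> \<ge> 0"
  shows
    "(traj_adv G \<tau> > 0 \<and>
        (\<forall>i\<in>acts \<tau>. \<forall>j\<in>acts \<tau>. phi_pos D i = phi_pos D j) \<and>
        (\<forall>i\<in>acts \<tau>. \<forall>j\<in>acts \<tau>. phi_neg D i = phi_neg D j) \<longrightarrow>
        (\<forall>i\<in>acts \<tau>. mult_pos c \<tau> D i = 1 \<and> mult_neg c \<tau> D i = 1 \<and>
           routing_weight c \<beta> G \<tau> D i = 1 \<and>
           (\<forall>l\<in>{1..tokens \<tau> i}. routed_adv c \<beta> G \<tau> D i l = traj_adv G \<tau>)))
     \<and>
     (traj_adv G \<tau> < 0 \<and>
        (\<forall>i\<in>acts \<tau>. \<forall>j\<in>acts \<tau>. phi_neg D i = phi_neg D j) \<longrightarrow>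
        (\<forall>i\<in>acts \<tau>. mult_neg c \<tau> D i = 1 \<and>
           routing_weight c \<beta> G \<tau> D i = 1 \<and>
           (\<forall>l\<in>{1..tokens \<tau> i}. routed_adv c \<beta> G \<tau> D i l = traj_adv G \<tau>)))
     \<and>
     ((\<forall>i\<in>acts \<tau>. err D i = 0) \<longrightarrow>
        (\<forall>i\<in>acts \<tau>. \<forall>j\<in>acts \<tau>. phi_neg D i = phi_neg D j) \<and>
        (\<forall>i\<in>acts \<tau>. weight_neg c \<tau> D i = 1))"
proof -
  have valid: "valid_rollout \<tau>"
    using assms by blast
  have pos: "mult_pos c \<tau> D i = 1"
    if "\<forall>i\<in>acts \<tau>. \<forall>j\<in>acts \<tau>. phi_pos D i = phi_pos D j" and "i \<in> acts \<tau>" for i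
    unfolding mult_pos_def using multiplier_const[OF valid that] .
  have neg: "mult_neg c \<tau> D i = 1"
    if "\<forall>i\<in>acts \<tau>. \<forall>j\<in>acts \<tau>. phi_neg D i = phi_neg D j" and "i \<in> acts \<tau>" for i
    unfolding mult_neg_def using multiplier_const[OF valid that] .
  \<comment> \<open>No sign is assumed: for a vanishing trajectory advantage both sides are
    0.\<close>
  have adv: "routed_adv c \<beta> G \<tau> D i l = traj_adv G \<tau>"
    if "routing_weight c \<beta> G \<tau> D i = 1" for i l
    using that by (simp add: routed_adv_def)
  have weight_pos: "routing_weight c \<beta> G \<tau> D i = 1"
    if "traj_adv G \<tau> > 0" and "weight_pos c \<beta> \<tau> D i = 1" for i
    using that by (simp add: routing_weight_def)
  have weight_neg: "routing_weight c \<beta> G \<tau> D i = 1"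
    if "traj_adv G \<tau> < 0" and "mult_neg c \<tau> D i = 1" for i
    using that by (simp add: routing_weight_def weight_neg_def)
  \<comment> \<open>The error indicator multiplies the whole degree term, so both sides become ln
    1.\<close>
  have no_err: "\<forall>i\<in>acts \<tau>. \<forall>j\<in>acts \<tau>. phi_neg D i = phi_neg D j"
    if "\<forall>i\<in>acts \<tau>. err D i = 0"
    using that by (simp add: phi_neg_def)
  show ?thesis
    \<comment> \<open>This turns the last claim into one about \<open>mult_neg\<close>, so that
      \<open>neg\<close> combined with \<open>no_err\<close> settles it.\<close>
    unfolding weight_neg_def
    by (intro conjI impI ballI; (elim conjE)?)
      (blast intro: adv weight_pos weight_neg pos neg weight_pos_const[OF valid] no_err[rule_format])+
qed

end
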